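(* Let $\mathcal{H}$ be a complex separable Hilbert space and let $\mathcal{M},\mathcal{N}$ be operator ranges in $\mathcal{H}$. Then there exist bounded positive (semi-definite) operators $X,C$ on the Hilbert space $\overline{\mathcal{M}+\mathcal{N}}$, with $X$ a quasi-affinity and $C$ a contraction, and an operator range $\mathcal{S}\subseteq\overline{\mathcal{M}+\mathcal{N}}$, such that $$P_{\mathcal{M},\mathcal{N}}X=X\bigl(C\ \hat{\dotplus}\ (\{0\}\times\mathcal{S})\bigr).$$
   Context: A linear relation on a Hilbert space $\mathcal{K}$ is a linear subspace of $\mathcal{K}\times\mathcal{K}$; operators are identified with their graphs. The product of relations is $RT=\{(x,y):(x,z)\in T,(z,y)\in R\text{ for some }z\}$. $T\,\hat{\dotplus}\,S$ is the sum of $T$ and $S$ as subspaces of $\mathcal{K}\times\mathcal{K}$, with $T\cap S=\{0\}$. An operator range is a linear subspace which is the range of a bounded operator on the Hilbert space. For subspaces $\mathcal{M},\mathcal{N}$, $P_{\mathcal{M},\mathcal{N}}=\{(m+n,m):m\in\mathcal{M},n\in\mathcal{N}\}$; here it is regarded as a linear relation on $\overline{\mathcal{M}+\mathcal{N}}$. A quasi-affinity is a bounded operator that is injective with dense range. *)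

theory Defs
  imports "HOL-Analysis.Analysis" "HOL-Library.Nonpos_Ints" "HOL-Library.Set_Algebras"
begin

text \<open>
  Complex Hilbert spaces. The real structure (norm, topology and real inner product) is the
  one underlying the complex structure: the real inner product is the real part of the complex
  one, so that norm x = sqrt (Re (cinner x x)). The complex inner product is linear in its
  first argument.
\<close>

class chilbert_space = real_inner + complete_space +
  fixes scaleC :: "complex \<Rightarrow> 'a \<Rightarrow> 'a"  (infixr \<open>*c\<close> 75)
    and cinner :: "'a \<Rightarrow> 'a \<Rightarrow> complex"
  assumes scaleR_scaleC: "scaleR r x = complex_of_real r *c x"
    and scaleC_add_right: "a *c (x + y) = a *c x + a *c y"
    and scaleC_add_left: "(a + b) *c x = a *c x + b *c x"
    and scaleC_scaleC: "a *c (b *c x) = (a * b) *c x"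
    and cinner_commute: "cinner x y = cnj (cinner y x)"
    and cinner_add_left: "cinner (x + y) z = cinner x z + cinner y z"
    and cinner_scaleC_left: "cinner (a *c x) y = a * cinner x y"
    and inner_eq_Re_cinner: "inner x y = Re (cinner x y)"

lemma scaleC_one: "1 *c x = (x :: 'a :: chilbert_space)"
  using scaleR_scaleC[of 1 x] by simp

global_interpretation complex_vector:
  vector_space "scaleC :: complex \<Rightarrow> 'a \<Rightarrow> 'a :: chilbert_space"
  by unfold_locales
    (simp_all add: scaleC_add_right scaleC_add_left scaleC_scaleC scaleC_one)

instantiation complex :: chilbert_space
begin

definition scaleC_complex :: "complex \<Rightarrow> complex \<Rightarrow> complex"
  where "scaleC_complex a x = a * x"

definition cinner_complex :: "complex \<Rightarrow> complex \<Rightarrow> complex"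
  where "cinner_complex x y = x * cnj y"

instance
  by standard
    (auto simp: scaleC_complex_def cinner_complex_def scaleR_conv_of_real algebra_simps
      inner_complex_def)

end

text \<open>
  The operators and relations live on closed subspaces K of the ambient space. Such a K is
  itself a Hilbert space; an operator on K is a function on the ambient type of which only
  the values on K matter.
\<close>

definition bounded_operator :: "'a::chilbert_space set \<Rightarrow> ('a \<Rightarrow> 'a) \<Rightarrow> bool"
  where "bounded_operator K T \<longleftrightarrow>
    T ` K \<subseteq> K \<and>
    (\<forall>x\<in>K. \<forall>y\<in>K. T (x + y) = T x + T y) \<and>
    (\<forall>a. \<forall>x\<in>K. T (a *c x) = a *c T x) \<and>
    (\<exists>B. \<forall>x\<in>K. norm (T x) \<le> B * norm x)"

definition positive_operator :: "'a::chilbert_space set \<Rightarrow> ('a \<Rightarrow> 'a) \<Rightarrow> bool"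
  where "positive_operator K T \<longleftrightarrow>
    bounded_operator K T \<and> (\<forall>x\<in>K. cinner (T x) x \<in> \<real>\<^sub>\<ge>\<^sub>0)"

definition contraction :: "'a::chilbert_space set \<Rightarrow> ('a \<Rightarrow> 'a) \<Rightarrow> bool"
  where "contraction K T \<longleftrightarrow> bounded_operator K T \<and> (\<forall>x\<in>K. norm (T x) \<le> norm x)"

definition quasi_affinity :: "'a::chilbert_space set \<Rightarrow> ('a \<Rightarrow> 'a) \<Rightarrow> bool"
  where "quasi_affinity K T \<longleftrightarrow>
    bounded_operator K T \<and> inj_on T K \<and> K \<subseteq> closure (T ` K)"

definition operator_range :: "'a::chilbert_space set \<Rightarrow> 'a set \<Rightarrow> bool"
  where "operator_range K S \<longleftrightarrow>
    complex_vector.subspace S \<and> (\<exists>T. bounded_operator K T \<and> S = T ` K)"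

definition graph_on :: "'a set \<Rightarrow> ('a \<Rightarrow> 'a) \<Rightarrow> ('a \<times> 'a) set"
  where "graph_on K T = {(x, T x) | x. x \<in> K}"

text \<open>The product of relations applies the right factor first, unlike relcomp.\<close>

definition rel_mult :: "('a \<times> 'a) set \<Rightarrow> ('a \<times> 'a) set \<Rightarrow> ('a \<times> 'a) set"  (infixl \<open>\<odot>\<close> 76)
  where "R \<odot> T = {(x, y). \<exists>z. (x, z) \<in> T \<and> (z, y) \<in> R}"

definition proj_rel :: "'a::plus set \<Rightarrow> 'a set \<Rightarrow> ('a \<times> 'a) set"
  where "proj_rel M N = {(m + n, m) | m n. m \<in> M \<and> n \<in> N}"

end

theory Submission
  imports Defs
begin

text \<open>Let M and N be the ranges of A and B, and let X be the positive square root of A A* + B B*.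
  Its range is M + N, so it is injective with dense range on K. By Douglas' lemma A = X A1 and
  B = X B1 with A1, B1 mapping into K, and A1 A1* + B1 B1* is the identity of K. After cancelling X,
  the projection relation consists of the pairs (A1 u + B1 v, A1 u). It contains the graph of
  C = A1 A1*, and its multivalued part S is the intersection of the ranges of A1 and B1, which is
  the range of (u, v) \<open>\<mapsto>\<close> C B1 v + (I - C) A1 u. The last range is also that of a
  positive operator on K.\<close>

section \<open>Representation of functionals and adjoints\<close>

text \<open>The relation is genuinely multivalued when \<open>M\<close> and \<open>N\<close> meet,
  and its single-valued part may be unbounded. An \<open>X\<close> with range exactly
  \<open>M + N\<close> absorbs the unboundedness: each \<open>A u + B v\<close> pulls back along
  \<open>X\<close> to one vector of \<open>K\<close>, unique because the kernel of a self-adjoint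
  operator is orthogonal to its range. The identity for \<open>A1\<close> and \<open>B1\<close>
  comes from \<open>adjoint A x = adjoint A1 (X x)\<close> and its analogue for \<open>B\<close>:
  composing \<open>C + D\<close> with \<open>X\<close> on both sides gives \<open>X X\<close>, where
  one \<open>X\<close> cancels by injectivity on \<open>K\<close> and the other by density of its
  range.

  Square roots, adjoints and factorisations are built over the real inner product, because the pair
  map sending (u, v) to \<open>A u + B v\<close> lives on a product type with its real Hilbert
  structure. Complex linearity is recovered afterwards: a square root commutes with whatever
  commutes with the operator, in particular with complex scalars, and a factor through
  \<open>X\<close> with values in \<open>K\<close> is unique. As \<open>K\<close> is a set and not a
  type, operators act on the whole ambient space and are shown to map \<open>K\<close> into
  itself.\<close>

text \<open>A minimising sequence y n of norm (L y) ^ 2 - 2 * f y need not converge, but L (y n)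
  does, by the parallelogram law.\<close>

lemma riesz_representation_range:
  fixes L :: "'b::real_vector \<Rightarrow> 'a::{real_inner,complete_space}" and f :: "'b \<Rightarrow> real"
  assumes L: "linear L" and f: "linear f" and le: "\<And>y. \<bar>f y\<bar> \<le> c * norm (L y)"
  obtains z where "z \<in> closure (range L)" "\<And>y. inner z (L y) = f y"
proof -
  define \<Phi> where "\<Phi> = (\<lambda>y. (norm (L y))\<^sup>2 - 2 * f y)"
  define m where "m = Inf (range \<Phi>)"
  have "- c\<^sup>2 \<le> \<Phi> y" for y
  proof -
    have "0 \<le> (norm (L y) - c)\<^sup>2" by simp
    moreover have "f y \<le> c * norm (L y)" using le[of y] by linarith
    ultimately show ?thesis by (simp add: \<Phi>_def power2_diff algebra_simps)
  qed
  then have bdd: "bdd_below (range \<Phi>)" by (auto intro!: bdd_belowI)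
  have m_le: "m \<le> \<Phi> y" for y
    unfolding m_def by (rule cInf_lower[OF _ bdd]) simp
  have "\<exists>y. \<Phi> y < m + inverse (real (Suc n))" for n
  proof -
    have "m < m + inverse (real (Suc n))" by simp
    then show ?thesis
      unfolding m_def using cInf_lessD[of "range \<Phi>"] by blast
  qed
  then obtain y where y: "\<And>n. \<Phi> (y n) < m + inverse (real (Suc n))" by metis
  \<comment> \<open>The midpoint of \<open>u\<close> and \<open>v\<close> is tested against
    \<open>m\<close>; since \<open>f\<close> is linear its terms cancel, leaving only the excesses
    of \<open>\<Phi> u\<close> and \<open>\<Phi> v\<close> over \<open>m\<close>.\<close>
  have par: "(norm (L u - L v))\<^sup>2 \<le> 2 * (\<Phi> u - m) + 2 * (\<Phi> v - m)" for u v
  proof -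
    have Lh: "L ((1/2) *\<^sub>R (u + v)) = (1/2) *\<^sub>R (L u + L v)"
      and fh: "f ((1/2) *\<^sub>R (u + v)) = (f u + f v) / 2"
      by (simp_all add: linear_cmul[OF L] linear_add[OF L] linear_cmul[OF f] linear_add[OF f])
    have "m \<le> \<Phi> ((1/2) *\<^sub>R (u + v))" by (rule m_le)
    also have "\<dots> = (norm (L u + L v))\<^sup>2 / 4 - (f u + f v)"
      unfolding \<Phi>_def Lh fh norm_scaleR by (simp add: power_divide add_divide_distrib)
    also have "(norm (L u + L v))\<^sup>2 = 2 * (norm (L u))\<^sup>2 + 2 * (norm (L v))\<^sup>2 - (norm (L u - L v))\<^sup>2"
      by (simp add: power2_norm_eq_inner inner_add_left inner_add_right inner_diff_left
          inner_diff_right inner_commute)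
    finally show ?thesis unfolding \<Phi>_def by argo
  qed
  have "Cauchy (\<lambda>n. L (y n))"
  proof (rule metric_CauchyI)
    fix e :: real
    assume "0 < e"
    \<comment> \<open>Two excesses enter \<open>par\<close>, each with factor 2, hence the
      quarter.\<close>
    then have "0 < e\<^sup>2 / 4" by simp
    then obtain N where N: "inverse (real (Suc N)) < e\<^sup>2 / 4"
      using reals_Archimedean by blast
    have "dist (L (y j)) (L (y k)) < e" if "j \<ge> N" "k \<ge> N" for j k
    proof -
      have "inverse (real (Suc j)) \<le> inverse (real (Suc N))" "inverse (real (Suc k)) \<le> inverse (real (Suc N))"
        using that by (auto intro!: le_imp_inverse_le)
      then have "(norm (L (y j) - L (y k)))\<^sup>2 < e\<^sup>2"
        using par[of "y j" "y k"] y[of j] y[of k] N by argo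
      then show ?thesis
        using \<open>0 < e\<close> by (simp add: dist_norm power2_less_imp_less)
    qed
    then show "\<exists>N. \<forall>j\<ge>N. \<forall>k\<ge>N. dist (L (y j)) (L (y k)) < e" by blast
  qed
  then obtain z where z: "(\<lambda>n. L (y n)) \<longlonglongrightarrow> z"
    using Cauchy_convergent_iff convergent_def by blast
  have "z \<in> closure (range L)"
    unfolding closure_sequential by (intro exI[of _ "\<lambda>n. L (y n)"]) (simp add: z)
  moreover have "inner z (L w) = f w" for w
  proof -
    define \<delta> where "\<delta> = inner z (L w) - f w"
    \<comment> \<open>The infimum need not be attained, so the first variation in direction
      \<open>w\<close> is taken at \<open>y n\<close>, with an error below
      \<open>inverse (real (Suc n))\<close>, and only its limit is used.\<close>
    have quad: "0 \<le> 2 * t * \<delta> + t\<^sup>2 * (norm (L w))\<^sup>2" for t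
    proof -
      have *: "- inverse (real (Suc n)) \<le> 2 * t * (inner (L (y n)) (L w) - f w) + t\<^sup>2 * (norm (L w))\<^sup>2" for n
      proof -
        have "L (y n + t *\<^sub>R w) = L (y n) + t *\<^sub>R L w" "f (y n + t *\<^sub>R w) = f (y n) + t * f w"
          by (simp_all add: linear_cmul[OF L] linear_add[OF L] linear_cmul[OF f] linear_add[OF f])
        moreover have "(norm (L (y n) + t *\<^sub>R L w))\<^sup>2
            = (norm (L (y n)))\<^sup>2 + 2 * t * inner (L (y n)) (L w) + t\<^sup>2 * (norm (L w))\<^sup>2"
          unfolding power2_norm_eq_inner
          by (simp add: inner_add_left inner_add_right inner_commute) (simp add: power2_eq_square)
        ultimately have "\<Phi> (y n + t *\<^sub>R w) - \<Phi> (y n) = 2 * t * (inner (L (y n)) (L w) - f w) + t\<^sup>2 * (norm (L w))\<^sup>2"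
          unfolding \<Phi>_def by (simp add: right_diff_distrib)
        then show ?thesis using m_le[of "y n + t *\<^sub>R w"] y[of n] by linarith
      qed
      have "(\<lambda>n. 2 * t * (inner (L (y n)) (L w) - f w) + t\<^sup>2 * (norm (L w))\<^sup>2)
          \<longlonglongrightarrow> 2 * t * \<delta> + t\<^sup>2 * (norm (L w))\<^sup>2"
        unfolding \<delta>_def by (intro tendsto_intros z)
      moreover have "(\<lambda>n. - inverse (real (Suc n))) \<longlonglongrightarrow> - 0"
        by (intro tendsto_minus LIMSEQ_inverse_real_of_nat)
      ultimately have "- 0 \<le> 2 * t * \<delta> + t\<^sup>2 * (norm (L w))\<^sup>2"
        using * by (intro LIMSEQ_le) auto
      then show ?thesis by simp
    qed
    \<comment> \<open>The summand 1 keeps the step \<open>t = - \<delta> / a\<close> defined when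
      \<open>L w = 0\<close>. Multiplied by the square of \<open>a\<close>, the bound
      \<open>quad\<close> then has a nonpositive right-hand side.\<close>
    define a where "a = (norm (L w))\<^sup>2 + 1"
    have "a > 0" unfolding a_def by (simp add: add_nonneg_pos)
    have "0 \<le> a\<^sup>2 * (2 * (- \<delta> / a) * \<delta> + (- \<delta> / a)\<^sup>2 * (norm (L w))\<^sup>2)"
      using quad[of "- \<delta> / a"] by simp
    also have "\<dots> = - \<delta>\<^sup>2 * (a + 1)"
    proof -
      have n: "(norm (L w))\<^sup>2 = a - 1" by (simp add: a_def)
      have q: "a\<^sup>2 * (2 * q * \<delta> + q\<^sup>2 * b) = 2 * a * (a * q) * \<delta> + (a * q)\<^sup>2 * b" for q b
        by (simp add: distrib_left power2_eq_square)
      show ?thesis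
        unfolding n q using \<open>a > 0\<close> by (simp add: algebra_simps power2_eq_square)
    qed
    finally have "\<delta>\<^sup>2 * (a + 1) \<le> 0" by simp
    then have "\<delta> = 0" using \<open>a > 0\<close> by (simp add: mult_le_0_iff)
    then show ?thesis by (simp add: \<delta>_def)
  qed
  ultimately show ?thesis using that by blast
qed

text \<open>Approximating \<open>z\<close> itself from \<open>U\<close> bounds its squared norm by
  \<open>c * norm z\<close>. Dividing by \<open>norm z\<close> fails only for \<open>z = 0\<close>,
  and as \<open>c\<close> may be negative this case stays as a disjunct.\<close>

lemma norm_le_if_inner_le_on_dense:
  fixes z :: "'a::real_inner"
  assumes z: "z \<in> closure U" and le: "\<And>u. u \<in> U \<Longrightarrow> inner z u \<le> c * norm u"
  shows "norm z \<le> c \<or> z = 0"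
proof -
  obtain u where u: "\<And>n. u n \<in> U" "u \<longlonglongrightarrow> z"
    using z unfolding closure_sequential by blast
  have "(\<lambda>n. inner z (u n)) \<longlonglongrightarrow> inner z z" "(\<lambda>n. c * norm (u n)) \<longlonglongrightarrow> c * norm z"
    by (intro tendsto_intros u)+
  then have "inner z z \<le> c * norm z"
    using LIMSEQ_le le u(1) by blast
  then have "norm z * norm z \<le> c * norm z"
    by (simp flip: power2_norm_eq_inner power2_eq_square)
  then show ?thesis by auto
qed

lemma eq_zero_if_orthogonal_dense:
  fixes z :: "'a::real_inner"
  assumes "z \<in> closure U" "\<And>u. u \<in> U \<Longrightarrow> inner z u = 0"
  shows "z = 0"
  using norm_le_if_inner_le_on_dense[of z U 0] assms by auto

context
  fixes T :: "'b::{real_inner,complete_space} \<Rightarrow> 'a::real_inner"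
  assumes T: "bounded_linear T"
begin

text \<open>\<open>adjoint\<close> is defined by choice, so existence suffices; it is the Riesz
  theorem, obtained by taking the identity for \<open>L\<close>.\<close>

lemma hilbert_adjoint_works: "inner (T x) y = inner x (adjoint T y)"
proof -
  interpret bounded_linear T by (rule T)
  obtain B where B: "\<And>x. norm (T x) \<le> norm x * B" using bounded by blast
  have "\<exists>w. \<forall>x. inner (T x) y = inner x w" for y
  proof -
    have "\<bar>inner (T x) y\<bar> \<le> (B * norm y) * norm x" for x
      using Cauchy_Schwarz_ineq2[of "T x" y] mult_right_mono[OF B[of x], of "norm y"]
      by (simp add: algebra_simps)
    moreover have "linear (\<lambda>x. inner (T x) y)"
      by (rule linearI) (simp_all add: add scale inner_simps)
    ultimately obtain w where "\<And>x. inner w x = inner (T x) y"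
      using riesz_representation_range[of "\<lambda>x. x" "\<lambda>x. inner (T x) y" "B * norm y"] linear_id
      by (auto simp: id_def)
    then show ?thesis by (metis inner_commute)
  qed
  then have "\<exists>S. \<forall>x y. inner (T x) y = inner x (S y)" by metis
  then show ?thesis
    unfolding adjoint_def by (rule someI2_ex) simp
qed

lemma hilbert_adjoint_norm_le:
  assumes "\<And>x. norm (T x) \<le> B * norm x" "B \<ge> 0"
  shows "norm (adjoint T y) \<le> B * norm y"
proof -
  have "norm (adjoint T y) * norm (adjoint T y) = inner (T (adjoint T y)) y"
    by (simp add: hilbert_adjoint_works flip: power2_norm_eq_inner power2_eq_square)
  also have "\<dots> \<le> norm (T (adjoint T y)) * norm y"
    by (rule norm_cauchy_schwarz)
  also have "\<dots> \<le> (B * norm y) * norm (adjoint T y)"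
    using mult_right_mono[OF assms(1)[of "adjoint T y"], of "norm y"] by (simp add: algebra_simps)
  finally show ?thesis
    using assms(2) by (cases "adjoint T y = 0") auto
qed

lemma bounded_linear_hilbert_adjoint: "bounded_linear (adjoint T)"
proof -
  interpret bounded_linear T by (rule T)
  obtain B where B: "B \<ge> 0" "\<And>x. norm (T x) \<le> norm x * B" using nonneg_bounded by blast
  show ?thesis
  proof (rule bounded_linear_intro)
    fix x y r
    show "adjoint T (x + y) = adjoint T x + adjoint T y"
      by (rule vector_eq_ldot[THEN iffD1]) (simp add: inner_simps flip: hilbert_adjoint_works)
    show "adjoint T (r *\<^sub>R x) = r *\<^sub>R adjoint T x"
      by (rule vector_eq_ldot[THEN iffD1]) (simp add: inner_simps flip: hilbert_adjoint_works)
    show "norm (adjoint T x) \<le> norm x * B"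
      using hilbert_adjoint_norm_le[of B x] B by (simp add: mult.commute)
  qed
qed

lemma hilbert_adjoint_works2: "inner (adjoint T y) x = inner y (T x)"
  by (metis hilbert_adjoint_works inner_commute)

end

section \<open>Square roots of positive operators\<close>

text \<open>Visser's iteration: a fixed point Y of Y = (E + Y Y) / 2 satisfies (I - Y)(I - Y) = I - E.
  Its scalar version for E = 1 controls the differences of the operator version in norm.\<close>

primrec sqrt_iter :: "('a::real_vector \<Rightarrow> 'a) \<Rightarrow> nat \<Rightarrow> 'a \<Rightarrow> 'a" where
  "sqrt_iter E 0 x = 0"
| "sqrt_iter E (Suc n) x = (1/2) *\<^sub>R (E x + sqrt_iter E n (sqrt_iter E n x))"

primrec sqrt_bound :: "nat \<Rightarrow> real" where
  "sqrt_bound 0 = 0"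
| "sqrt_bound (Suc n) = (1 + (sqrt_bound n)\<^sup>2) / 2"

lemma sqrt_bound_nonneg: "0 \<le> sqrt_bound n"
  by (induction n) auto

lemma sqrt_bound_le_1: "sqrt_bound n \<le> 1"
  by (induction n) (auto simp: power_le_one sqrt_bound_nonneg)

lemma sqrt_bound_le_Suc: "sqrt_bound n \<le> sqrt_bound (Suc n)"
proof -
  have "0 \<le> (sqrt_bound n - 1)\<^sup>2" by simp
  then show ?thesis by (simp add: power2_diff)
qed

lemma Cauchy_sqrt_bound: "Cauchy sqrt_bound"
proof -
  have "incseq sqrt_bound" using sqrt_bound_le_Suc by (rule incseq_SucI)
  then show ?thesis
    using incseq_convergent sqrt_bound_le_1 by (metis LIMSEQ_imp_Cauchy)
qed

lemma linear_sqrt_iter: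
  assumes "linear E"
  shows "linear (sqrt_iter E n)"
proof (induction n)
  case 0
  show ?case by (rule linearI) simp_all
next
  case (Suc n)
  show ?case
    by (rule linearI)
      (simp_all add: linear_add[OF Suc] linear_cmul[OF Suc] linear_add[OF assms] linear_cmul[OF assms]
        scaleR_add_right scaleR_left_commute)
qed

text \<open>Every iterate is a polynomial in \<open>E\<close> without constant term. Applied to
  multiplication by complex scalars, this is the source of the complex linearity of the square
  root.\<close>

lemma sqrt_iter_commute:
  assumes "linear W" "\<And>x. W (E x) = E (W x)"
  shows "W (sqrt_iter E n x) = sqrt_iter E n (W x)"
  by (induction n arbitrary: x)
    (simp_all add: assms(2) linear_0[OF assms(1)] linear_add[OF assms(1)] linear_cmul[OF assms(1)]
      del: scaleR_add_right)

lemma sqrt_iter_selfadjoint: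
  fixes E :: "'a::real_inner \<Rightarrow> 'a"
  assumes "\<And>x y. inner (E x) y = inner x (E y)"
  shows "inner (sqrt_iter E n x) y = inner x (sqrt_iter E n y)"
proof (induction n arbitrary: x y)
  case (Suc n)
  then show ?case by (simp add: inner_add_left inner_add_right assms)
qed simp

lemma norm_sqrt_iter_le:
  fixes E :: "'a::real_normed_vector \<Rightarrow> 'a"
  assumes "\<And>x. norm (E x) \<le> norm x"
  shows "norm (sqrt_iter E n x) \<le> sqrt_bound n * norm x"
proof (induction n arbitrary: x)
  case (Suc n)
  have "norm (sqrt_iter E n (sqrt_iter E n x)) \<le> sqrt_bound n * norm (sqrt_iter E n x)"
    by (rule Suc)
  also have "\<dots> \<le> sqrt_bound n * (sqrt_bound n * norm x)"
    by (rule mult_left_mono[OF Suc sqrt_bound_nonneg])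
  finally have "norm (E x + sqrt_iter E n (sqrt_iter E n x)) \<le> norm x + (sqrt_bound n)\<^sup>2 * norm x"
    using assms[of x] norm_triangle_ineq[of "E x" "sqrt_iter E n (sqrt_iter E n x)"]
    by (simp add: power2_eq_square)
  then show ?case by (simp add: algebra_simps del: scaleR_add_right)
qed simp

text \<open>For consecutive iterates \<open>Y\<close>, \<open>Z\<close> with bounds
  \<open>s\<close>, \<open>t\<close>, write Z Z - Y Y = Z (Z - Y) + (Z - Y) Y. The two terms are
  bounded by t (t - s) and (t - s) s, whose sum is the difference of squares in the scalar
  recursion.\<close>

lemma norm_sqrt_iter_Suc_diff_le:
  fixes E :: "'a::real_normed_vector \<Rightarrow> 'a"
  assumes "linear E" "\<And>x. norm (E x) \<le> norm x"
  shows "norm (sqrt_iter E (Suc n) x - sqrt_iter E n x) \<le> (sqrt_bound (Suc n) - sqrt_bound n) * norm x"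
proof (induction n arbitrary: x)
  case 0
  then show ?case using assms(2)[of x] by simp
next
  case (Suc n)
  define Y where "Y = sqrt_iter E n"
  define Z where "Z = sqrt_iter E (Suc n)"
  define s where "s = sqrt_bound n"
  define t where "t = sqrt_bound (Suc n)"
  have IH: "norm (Z x - Y x) \<le> (t - s) * norm x" for x
    using Suc unfolding Y_def Z_def s_def t_def .
  have nn: "0 \<le> s" "0 \<le> t" "s \<le> t"
    unfolding s_def t_def by (rule sqrt_bound_nonneg sqrt_bound_le_Suc)+
  have linZ: "linear Z" unfolding Z_def by (rule linear_sqrt_iter[OF assms(1)])
  have "norm (Z (Z x - Y x)) \<le> t * norm (Z x - Y x)"
    unfolding Z_def t_def by (rule norm_sqrt_iter_le[OF assms(2)])
  also have "\<dots> \<le> t * ((t - s) * norm x)" by (rule mult_left_mono[OF IH nn(2)])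
  finally have 1: "norm (Z (Z x) - Z (Y x)) \<le> t * (t - s) * norm x"
    using linear_diff[OF linZ] by simp
  have "norm (Z (Y x) - Y (Y x)) \<le> (t - s) * norm (Y x)" by (rule IH)
  also have "\<dots> \<le> (t - s) * (s * norm x)"
    unfolding Y_def s_def using nn norm_sqrt_iter_le[of E, OF assms(2)]
    by (intro mult_left_mono) (auto simp: s_def t_def simp del: sqrt_bound.simps)
  finally have "norm (Z (Z x) - Y (Y x)) \<le> t * (t - s) * norm x + (t - s) * (s * norm x)"
    using 1 norm_triangle_ineq[of "Z (Z x) - Z (Y x)" "Z (Y x) - Y (Y x)"] by simp
  also have "\<dots> = (t\<^sup>2 - s\<^sup>2) * norm x" by (simp add: algebra_simps power2_eq_square)
  finally have "norm ((1/2) *\<^sub>R (Z (Z x) - Y (Y x))) \<le> (t\<^sup>2 - s\<^sup>2) / 2 * norm x" by simp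
  moreover have "sqrt_iter E (Suc (Suc n)) x - sqrt_iter E (Suc n) x = (1/2) *\<^sub>R (Z (Z x) - Y (Y x))"
    unfolding sqrt_iter.simps(2)[of E "Suc n"] Z_def[symmetric]
    unfolding Z_def sqrt_iter.simps(2)[of E n x] Y_def[symmetric]
    by (simp add: algebra_simps)
  moreover have "sqrt_bound (Suc (Suc n)) - sqrt_bound (Suc n) = (t\<^sup>2 - s\<^sup>2) / 2"
    unfolding sqrt_bound.simps(2)[of "Suc n"] t_def[symmetric]
    by (simp add: t_def s_def field_simps)
  ultimately show ?case by metis
qed

lemma norm_sqrt_iter_diff_le:
  fixes E :: "'a::real_normed_vector \<Rightarrow> 'a"
  assumes "linear E" "\<And>x. norm (E x) \<le> norm x" "n \<le> m"
  shows "norm (sqrt_iter E m x - sqrt_iter E n x) \<le> (sqrt_bound m - sqrt_bound n) * norm x"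
  using assms(3)
proof (induction m rule: dec_induct)
  case (step m)
  have "norm (sqrt_iter E (Suc m) x - sqrt_iter E n x)
      \<le> norm (sqrt_iter E (Suc m) x - sqrt_iter E m x) + norm (sqrt_iter E m x - sqrt_iter E n x)"
    using norm_triangle_ineq[of "sqrt_iter E (Suc m) x - sqrt_iter E m x" "sqrt_iter E m x - sqrt_iter E n x"]
    by simp
  also have "\<dots> \<le> (sqrt_bound (Suc m) - sqrt_bound m) * norm x + (sqrt_bound m - sqrt_bound n) * norm x"
    by (intro add_mono norm_sqrt_iter_Suc_diff_le step assms)
  finally show ?case by (simp add: algebra_simps del: sqrt_bound.simps)
qed simp

lemma Cauchy_sqrt_iter:
  fixes E :: "'a::real_normed_vector \<Rightarrow> 'a"
  assumes "linear E" "\<And>x. norm (E x) \<le> norm x"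
  shows "Cauchy (\<lambda>n. sqrt_iter E n x)"
proof (rule metric_CauchyI)
  fix e :: real
  assume "0 < e"
  \<comment> \<open>Adding 1 avoids a division by zero at \<open>x = 0\<close>.\<close>
  then have "0 < e / (norm x + 1)" by (simp add: add_nonneg_pos)
  then obtain N where N: "\<And>m n. m \<ge> N \<Longrightarrow> n \<ge> N \<Longrightarrow> dist (sqrt_bound m) (sqrt_bound n) < e / (norm x + 1)"
    using Cauchy_sqrt_bound unfolding Cauchy_def by blast
  have less: "norm (sqrt_iter E m x - sqrt_iter E n x) < e" if "m \<ge> n" "n \<ge> N" for m n
  proof -
    have "norm (sqrt_iter E m x - sqrt_iter E n x) \<le> (sqrt_bound m - sqrt_bound n) * norm x"
      by (rule norm_sqrt_iter_diff_le[OF assms that(1)])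
    also have "\<dots> \<le> dist (sqrt_bound m) (sqrt_bound n) * (norm x + 1)"
      by (intro mult_mono) (auto simp: dist_real_def)
    also have "\<dots> < e"
      using N[of m n] that by (simp add: pos_less_divide_eq add_nonneg_pos)
    finally show ?thesis .
  qed
  have "dist (sqrt_iter E m x) (sqrt_iter E n x) < e" if "m \<ge> N" "n \<ge> N" for m n
    using less[of m n] less[of n m] that by (cases "n \<le> m") (auto simp: dist_norm norm_minus_commute)
  then show "\<exists>N. \<forall>m\<ge>N. \<forall>n\<ge>N. dist (sqrt_iter E m x) (sqrt_iter E n x) < e" by blast
qed

text \<open>For self-adjoint \<open>T\<close>, \<open>le\<close> says that \<open>T\<close> lies
  between 0 and the identity. In this form it makes \<open>E\<close>, the identity minus
  \<open>T\<close>, a contraction by expanding the square of \<open>norm (E x)\<close>, as the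
  iteration requires.\<close>

lemma positive_sqrt_contraction:
  fixes T :: "'a::{real_inner,complete_space} \<Rightarrow> 'a"
  assumes lin: "linear T" and sa: "\<And>x y. inner (T x) y = inner x (T y)"
    and le: "\<And>x. (norm (T x))\<^sup>2 \<le> inner (T x) x"
  obtains Q where "bounded_linear Q" "\<And>x y. inner (Q x) y = inner x (Q y)"
    "\<And>x. 0 \<le> inner (Q x) x" "\<And>x. Q (Q x) = T x"
    "\<And>W x. bounded_linear W \<Longrightarrow> (\<And>x. W (T x) = T (W x)) \<Longrightarrow> W (Q x) = Q (W x)"
proof -
  define E where "E = (\<lambda>x. x - T x)"
  have linE: "linear E"
    by (rule linearI) (simp_all add: E_def linear_add[OF lin] linear_cmul[OF lin] algebra_simps)
  have saE: "inner (E x) y = inner x (E y)" for x y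
    by (simp add: E_def inner_diff_left inner_diff_right sa)
  have nE: "norm (E x) \<le> norm x" for x
  proof -
    have "(norm (E x))\<^sup>2 = (norm x)\<^sup>2 - 2 * inner (T x) x + (norm (T x))\<^sup>2"
      by (simp add: E_def power2_norm_eq_inner inner_diff_left inner_diff_right inner_commute)
    also have "\<dots> \<le> (norm x)\<^sup>2"
      using le[of x] zero_le_power2[of "norm (T x)"] by linarith
    finally show ?thesis by simp
  qed
  have "\<exists>l. (\<lambda>n. sqrt_iter E n x) \<longlonglongrightarrow> l" for x
    using Cauchy_sqrt_iter[of E x, OF linE nE] Cauchy_convergent_iff convergent_def by blast
  then obtain Y where Y: "\<And>x. (\<lambda>n. sqrt_iter E n x) \<longlonglongrightarrow> Y x" by metis
  note linI = linear_sqrt_iter[OF linE]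
  have nI: "norm (sqrt_iter E n x) \<le> norm x" for n x
  proof -
    have "norm (sqrt_iter E n x) \<le> sqrt_bound n * norm x" by (rule norm_sqrt_iter_le[OF nE])
    also have "\<dots> \<le> 1 * norm x" by (intro mult_right_mono sqrt_bound_le_1) simp
    finally show ?thesis by simp
  qed
  have Yadd: "Y (x + y) = Y x + Y y" for x y
    using LIMSEQ_unique[OF Y] tendsto_add[OF Y[of x] Y[of y]] by (simp add: linear_add[OF linI])
  have Yscale: "Y (r *\<^sub>R x) = r *\<^sub>R Y x" for r x
    using LIMSEQ_unique[OF Y] tendsto_scaleR[OF tendsto_const Y[of x]] by (simp add: linear_cmul[OF linI])
  have nY: "norm (Y x) \<le> norm x" for x
    by (rule LIMSEQ_le_const2[OF tendsto_norm[OF Y]]) (use nI in blast)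
  have saY: "inner (Y x) y = inner x (Y y)" for x y
  proof -
    have "(\<lambda>n. inner (sqrt_iter E n x) y) \<longlonglongrightarrow> inner (Y x) y" by (intro tendsto_intros Y)
    moreover have "(\<lambda>n. inner (sqrt_iter E n x) y) \<longlonglongrightarrow> inner x (Y y)"
      unfolding sqrt_iter_selfadjoint[of E, OF saE] by (intro tendsto_intros Y)
    ultimately show ?thesis by (rule LIMSEQ_unique)
  qed
  have comm: "W (Y x) = Y (W x)" if W: "bounded_linear W" "\<And>x. W (T x) = T (W x)" for W x
  proof -
    interpret W: bounded_linear W by (rule W)
    have "W (E x) = E (W x)" for x by (simp add: E_def W.diff W(2))
    then have "W (sqrt_iter E n x) = sqrt_iter E n (W x)" for n
      by (rule sqrt_iter_commute[OF W.linear_axioms])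
    then have "(\<lambda>n. sqrt_iter E n (W x)) \<longlonglongrightarrow> W (Y x)"
      using W.tendsto[OF Y[of x]] by simp
    then show ?thesis using LIMSEQ_unique[OF Y[of "W x"]] by simp
  qed
  \<comment> \<open>Pointwise convergence alone does not pass through the composition of two
    iterates. The uniform bound \<open>nI\<close> allows the inner iterate to be replaced by its
    limit \<open>Y x\<close> first.\<close>
  have YY: "Y x = (1/2) *\<^sub>R (E x + Y (Y x))" for x
  proof -
    have "(\<lambda>n. sqrt_iter E n (sqrt_iter E n x) - sqrt_iter E n (Y x)) \<longlonglongrightarrow> 0"
    proof (rule Lim_null_comparison)
      have "norm (sqrt_iter E n (sqrt_iter E n x) - sqrt_iter E n (Y x)) \<le> norm (sqrt_iter E n x - Y x)" for n
        using nI[of n "sqrt_iter E n x - Y x"] by (simp add: linear_diff[OF linI])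
      then show "\<forall>\<^sub>F n in sequentially. norm (sqrt_iter E n (sqrt_iter E n x) - sqrt_iter E n (Y x))
          \<le> norm (sqrt_iter E n x - Y x)" by simp
      show "(\<lambda>n. norm (sqrt_iter E n x - Y x)) \<longlonglongrightarrow> 0"
        using Y[of x] by (simp add: LIM_zero tendsto_norm_zero)
    qed
    from tendsto_add[OF this Y[of "Y x"]]
    have "(\<lambda>n. sqrt_iter E n (sqrt_iter E n x)) \<longlonglongrightarrow> Y (Y x)" by simp
    then have "(\<lambda>n. sqrt_iter E (Suc n) x) \<longlonglongrightarrow> (1/2) *\<^sub>R (E x + Y (Y x))"
      unfolding sqrt_iter.simps by (intro tendsto_intros)
    then show ?thesis using LIMSEQ_unique[OF LIMSEQ_Suc[OF Y[of x]]] by blast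
  qed
  have Ydiff: "Y (x - y) = Y x - Y y" for x y
    using Yadd[of "x - y" y] by simp
  define Q where "Q = (\<lambda>x. x - Y x)"
  show ?thesis
  proof (rule that[of Q])
    show "bounded_linear Q"
    proof (rule bounded_linear_intro[where K=2])
      fix x show "norm (Q x) \<le> norm x * 2"
        using norm_triangle_ineq4[of x "Y x"] nY[of x] by (simp add: Q_def)
    qed (simp_all add: Q_def Yadd Yscale algebra_simps)
    fix x y
    show "inner (Q x) y = inner x (Q y)" by (simp add: Q_def inner_simps saY)
    have "inner (Y x) x \<le> norm (Y x) * norm x" by (rule norm_cauchy_schwarz)
    also have "\<dots> \<le> norm x * norm x" by (intro mult_right_mono nY) simp
    finally show "0 \<le> inner (Q x) x"
      by (simp add: Q_def inner_simps flip: power2_norm_eq_inner power2_eq_square)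
    have "2 *\<^sub>R Y x = E x + Y (Y x)" using arg_cong[OF YY[of x], of "\<lambda>u. 2 *\<^sub>R u"] by simp
    then show "Q (Q x) = T x"
      by (simp add: Q_def Ydiff E_def algebra_simps scaleR_2)
  next
    fix W x
    assume W: "bounded_linear W" "\<And>x. W (T x) = T (W x)"
    show "W (Q x) = Q (W x)"
      by (simp add: Q_def linear_diff[OF bounded_linear.linear[OF W(1)]] comm[OF W])
  qed
qed

text \<open>The hypothesis amounts to positivity of T together with norm T \<open>\<le>\<close> c.\<close>

lemma positive_sqrt:
  fixes T :: "'a::{real_inner,complete_space} \<Rightarrow> 'a"
  assumes lin: "linear T" and sa: "\<And>x y. inner (T x) y = inner x (T y)"
    and c: "c > 0" and le: "\<And>x. (norm (T x))\<^sup>2 \<le> c * inner (T x) x"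
  obtains Q where "bounded_linear Q" "\<And>x y. inner (Q x) y = inner x (Q y)"
    "\<And>x. 0 \<le> inner (Q x) x" "\<And>x. Q (Q x) = T x"
    "\<And>W x. bounded_linear W \<Longrightarrow> (\<And>x. W (T x) = T (W x)) \<Longrightarrow> W (Q x) = Q (W x)"
proof -
  define T' where "T' = (\<lambda>x. (1 / c) *\<^sub>R T x)"
  have "linear T'"
    by (rule linearI) (simp_all add: T'_def linear_add[OF lin] linear_cmul[OF lin] algebra_simps)
  moreover have "inner (T' x) y = inner x (T' y)" for x y by (simp add: T'_def sa)
  moreover have "(norm (T' x))\<^sup>2 \<le> inner (T' x) x" for x
    using c le[of x] by (simp add: T'_def power_divide field_simps power2_eq_square)
  ultimately obtain Q where Q: "bounded_linear Q" "\<And>x y. inner (Q x) y = inner x (Q y)"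
    "\<And>x. 0 \<le> inner (Q x) x" "\<And>x. Q (Q x) = T' x"
    "\<And>W x. bounded_linear W \<Longrightarrow> (\<And>x. W (T' x) = T' (W x)) \<Longrightarrow> W (Q x) = Q (W x)"
    using positive_sqrt_contraction[of T'] by blast
  interpret Q: bounded_linear Q by (rule Q(1))
  show ?thesis
  proof (rule that[of "\<lambda>x. sqrt c *\<^sub>R Q x"])
    show "bounded_linear (\<lambda>x. sqrt c *\<^sub>R Q x)"
      by (rule bounded_linear_const_scaleR[OF Q(1)])
    fix x y
    show "inner (sqrt c *\<^sub>R Q x) y = inner x (sqrt c *\<^sub>R Q y)" by (simp add: Q(2))
    show "0 \<le> inner (sqrt c *\<^sub>R Q x) x" using c Q(3) by simp
    show "sqrt c *\<^sub>R Q (sqrt c *\<^sub>R Q x) = T x" using c by (simp add: Q.scale Q(4) T'_def)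
  next
    fix W x
    assume W: "bounded_linear W" "\<And>x. W (T x) = T (W x)"
    interpret W: bounded_linear W by (rule W)
    have "W (T' x) = T' (W x)" for x by (simp add: T'_def W.scale W(2))
    then show "W (sqrt c *\<^sub>R Q x) = sqrt c *\<^sub>R Q (W x)"
      by (simp add: W.scale Q(5)[OF W(1)])
  qed
qed

section \<open>Factorisation and operator ranges\<close>

lemma subspace_closure:
  fixes U :: "'a::real_normed_vector set"
  assumes "subspace U"
  shows "subspace (closure U)"
proof (rule subspaceI)
  show "0 \<in> closure U" using subspace_0[OF assms] closure_subset by blast
next
  fix x y
  assume "x \<in> closure U" "y \<in> closure U"
  then obtain u v where "\<And>n. u n \<in> U" "u \<longlonglongrightarrow> x" "\<And>n. v n \<in> U" "v \<longlonglongrightarrow> y"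
    unfolding closure_sequential by blast
  then have "\<forall>n. u n + v n \<in> U" "(\<lambda>n. u n + v n) \<longlonglongrightarrow> x + y"
    by (auto intro: tendsto_add subspace_add[OF assms])
  then show "x + y \<in> closure U"
    unfolding closure_sequential by (intro exI[of _ "\<lambda>n. u n + v n"]) simp
next
  fix c x
  assume "x \<in> closure U"
  then obtain u where "\<And>n. u n \<in> U" "u \<longlonglongrightarrow> x"
    unfolding closure_sequential by blast
  then have "\<forall>n. c *\<^sub>R u n \<in> U" "(\<lambda>n. c *\<^sub>R u n) \<longlonglongrightarrow> c *\<^sub>R x"
    by (auto intro: tendsto_scaleR tendsto_const subspace_scale[OF assms])
  then show "c *\<^sub>R x \<in> closure U"
    unfolding closure_sequential by (intro exI[of _ "\<lambda>n. c *\<^sub>R u n"]) simp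
qed

text \<open>If \<open>X\<close> kills a difference of two such vectors, self-adjointness makes that
  difference orthogonal to \<open>range X\<close>, in whose closure it lies. This is what permits
  cancelling \<open>X\<close> on \<open>K\<close>.\<close>

lemma inj_on_closure_range_selfadjoint:
  fixes X :: "'a::real_inner \<Rightarrow> 'a"
  assumes X: "bounded_linear X" and sa: "\<And>x y. inner (X x) y = inner x (X y)"
  shows "inj_on X (closure (range X))"
proof (rule inj_onI)
  interpret bounded_linear X by (rule X)
  fix x y
  assume x: "x \<in> closure (range X)" and y: "y \<in> closure (range X)" and "X x = X y"
  have "x - y = 0"
  proof (rule eq_zero_if_orthogonal_dense[where U="range X"])
    have "subspace (closure (range X))"
      by (intro subspace_closure linear_subspace_image linear_axioms subspace_UNIV)
    then show "x - y \<in> closure (range X)" using x y by (rule subspace_diff)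
    show "inner (x - y) u = 0" if "u \<in> range X" for u
      using that \<open>X x = X y\<close> by (auto simp: diff simp flip: sa)
  qed
  then show "x = y" by simp
qed

text \<open>By \<open>le\<close> the functional sending \<open>X x\<close> to
  \<open>inner u (adjoint A x)\<close> is bounded, and a vector representing it solves
  \<open>X z = A u\<close>. Taking it in the closure of the range makes it unique, so the choice of
  \<open>z\<close> is linear in \<open>u\<close>.\<close>

lemma douglas_factorization:
  fixes X :: "'a::{real_inner,complete_space} \<Rightarrow> 'a" and A :: "'b::{real_inner,complete_space} \<Rightarrow> 'a"
  assumes X: "bounded_linear X" and sa: "\<And>x y. inner (X x) y = inner x (X y)"
    and A: "bounded_linear A" and le: "\<And>x. norm (adjoint A x) \<le> norm (X x)"
  obtains V where "bounded_linear V" "\<And>u. norm (V u) \<le> norm u"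
    "range V \<subseteq> closure (range X)" "\<And>u. X (V u) = A u"
proof -
  interpret X: bounded_linear X by (rule X)
  interpret A: bounded_linear A by (rule A)
  interpret A': bounded_linear "adjoint A" by (rule bounded_linear_hilbert_adjoint[OF A])
  have sub: "subspace (closure (range X))"
    by (intro subspace_closure linear_subspace_image X.linear_axioms subspace_UNIV)
  have "\<exists>z. z \<in> closure (range X) \<and> norm z \<le> norm u \<and> X z = A u" for u
  proof -
    have lin: "linear (\<lambda>x. inner u (adjoint A x))"
      by (rule linearI) (simp_all add: A'.add A'.scale inner_simps)
    have bd: "\<bar>inner u (adjoint A x)\<bar> \<le> norm u * norm (X x)" for x
      using Cauchy_Schwarz_ineq2[of u "adjoint A x"] mult_left_mono[OF le[of x], of "norm u"] by simp
    obtain z where z: "z \<in> closure (range X)" "\<And>x. inner z (X x) = inner u (adjoint A x)"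
      using riesz_representation_range[OF X.linear_axioms lin bd] by blast
    have "inner z w \<le> norm u * norm w" if "w \<in> range X" for w
      using that z(2) bd by (metis abs_le_D1 imageE)
    then have "norm z \<le> norm u"
      using norm_le_if_inner_le_on_dense[OF z(1), of "norm u"] by auto
    moreover have "X z = A u"
      by (rule vector_eq_rdot[THEN iffD1]) (simp add: sa z(2) hilbert_adjoint_works[OF A])
    ultimately show ?thesis using z(1) by blast
  qed
  then obtain V where V: "\<And>u. V u \<in> closure (range X)" "\<And>u. norm (V u) \<le> norm u" "\<And>u. X (V u) = A u"
    by metis
  note inj = inj_onD[OF inj_on_closure_range_selfadjoint[OF X sa]]
  have "bounded_linear V"
  proof (rule bounded_linear_intro[where K=1])
    fix u v r
    show "V (u + v) = V u + V v"
      by (rule inj) (simp_all add: V A.add X.add subspace_add[OF sub])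
    show "V (r *\<^sub>R u) = r *\<^sub>R V u"
      by (rule inj) (simp_all add: V A.scale X.scale subspace_scale[OF sub])
  qed (simp add: V)
  then show ?thesis using that V by blast
qed

text \<open>X is the modulus of the adjoint of R.\<close>

lemma range_eq_range_positive:
  fixes R :: "'b::{real_inner,complete_space} \<Rightarrow> 'a::{real_inner,complete_space}"
  assumes R: "bounded_linear R"
  obtains X where "bounded_linear X" "\<And>x y. inner (X x) y = inner x (X y)" "\<And>x. 0 \<le> inner (X x) x"
    "\<And>x. X (X x) = R (adjoint R x)" "range X = range R" "X ` closure (range X) = range X"
    "\<And>W x. bounded_linear W \<Longrightarrow> (\<And>x. W (R (adjoint R x)) = R (adjoint R (W x))) \<Longrightarrow> W (X x) = X (W x)"
proof -
  interpret R: bounded_linear R by (rule R)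
  interpret R': bounded_linear "adjoint R" by (rule bounded_linear_hilbert_adjoint[OF R])
  obtain B where B: "B > 0" "\<And>x. norm (R x) \<le> norm x * B" using R.pos_bounded by blast
  have RR: "inner (R (adjoint R x)) y = inner (adjoint R x) (adjoint R y)" for x y
    by (rule hilbert_adjoint_works[OF R])
  \<comment> \<open>With \<open>B\<close> a bound for \<open>R\<close>, the left side is at most the
    square of \<open>B\<close> times that of \<open>norm (adjoint R x)\<close>, and the latter
    square is the inner product on the right.\<close>
  have le: "(norm (R (adjoint R x)))\<^sup>2 \<le> B\<^sup>2 * inner (R (adjoint R x)) x" for x
    using power_mono[OF B(2)[of "adjoint R x"], of 2]
    by (simp add: RR power_mult_distrib mult.commute flip: power2_norm_eq_inner)
  have lin: "linear (\<lambda>x. R (adjoint R x))"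
    by (rule linearI) (simp_all add: R.add R'.add R.scale R'.scale)
  have sa: "inner (R (adjoint R x)) y = inner x (R (adjoint R y))" for x y
    using RR[of x y] RR[of y x] by (simp add: inner_commute)
  obtain X where X: "bounded_linear X" "\<And>x y. inner (X x) y = inner x (X y)"
    "\<And>x. 0 \<le> inner (X x) x" "\<And>x. X (X x) = R (adjoint R x)"
    "\<And>W x. bounded_linear W \<Longrightarrow> (\<And>x. W (R (adjoint R x)) = R (adjoint R (W x))) \<Longrightarrow> W (X x) = X (W x)"
    by (rule positive_sqrt[OF lin sa zero_less_power[OF B(1)] le]) blast
  interpret X: bounded_linear X by (rule X(1))
  have norm_eq: "norm (X x) = norm (adjoint R x)" for x
  proof -
    have "inner (X x) (X x) = inner (adjoint R x) (adjoint R x)"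
      unfolding RR[symmetric] X(4)[symmetric] by (simp only: X(2))
    then show ?thesis by (simp only: norm_eq_sqrt_inner)
  qed
  obtain V where V: "range V \<subseteq> closure (range X)" "\<And>u. X (V u) = R u"
    by (rule douglas_factorization[OF X(1,2) R eq_refl[OF norm_eq[symmetric]]]) blast
  have 1: "range R \<subseteq> X ` closure (range X)"
    using V by (metis image_subset_iff rangeI image_eqI)
  \<comment> \<open>The previous lemma factors through a self-adjoint operator, which
    \<open>R\<close> is not. Here the Riesz theorem along \<open>adjoint R\<close> directly solves
    \<open>R z = X u\<close>.\<close>
  have 2: "range X \<subseteq> range R"
  proof clarify
    fix u
    have lin: "linear (\<lambda>x. inner u (X x))"
      by (rule linearI) (simp_all add: X.add X.scale inner_simps)
    have bd: "\<bar>inner u (X x)\<bar> \<le> norm u * norm (adjoint R x)" for x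
      using Cauchy_Schwarz_ineq2[of u "X x"] by (simp add: norm_eq)
    obtain z where z: "\<And>x. inner z (adjoint R x) = inner u (X x)"
      using riesz_representation_range[OF R'.linear_axioms lin bd] by blast
    have "X u = R z"
      by (rule vector_eq_rdot[THEN iffD1]) (simp add: X(2) z hilbert_adjoint_works[OF R])
    then show "X u \<in> range R" by simp
  qed
  have "X ` closure (range X) \<subseteq> range X" by blast
  then have "range X = range R" "X ` closure (range X) = range X" using 1 2 by blast+
  then show ?thesis using that[of X] X by blast
qed

section \<open>Complex structure\<close>

lemma inner_scaleC_left:
  fixes x y :: "'a::chilbert_space"
  shows "inner (a *c x) y = inner x (cnj a *c y)"
proof -
  have "cinner x (cnj a *c y) = a * cinner x y"
    by (metis cinner_commute cinner_scaleC_left complex_cnj_cnj complex_cnj_mult)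
  then show ?thesis by (simp add: inner_eq_Re_cinner cinner_scaleC_left)
qed

lemma bounded_linear_scaleC: "bounded_linear (\<lambda>x::'a::chilbert_space. a *c x)"
proof (rule bounded_linear_intro[where K="cmod a"])
  fix x y :: 'a and r :: real
  show "a *c (x + y) = a *c x + a *c y" by (rule scaleC_add_right)
  show "a *c (r *\<^sub>R x) = r *\<^sub>R (a *c x)"
    by (simp add: scaleR_scaleC scaleC_scaleC mult.commute)
  have "inner (a *c x) (a *c x) = inner x ((cnj a * a) *c x)"
    by (simp add: inner_scaleC_left scaleC_scaleC)
  also have "cnj a * a = complex_of_real ((cmod a)\<^sup>2)"
    by (simp add: complex_norm_square mult.commute del: of_real_power)
  finally have "(norm (a *c x))\<^sup>2 = (norm x * cmod a)\<^sup>2"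
    by (simp add: power2_norm_eq_inner power_mult_distrib mult.commute flip: scaleR_scaleC)
  then show "norm (a *c x) \<le> norm x * cmod a"
    by - (rule power2_le_imp_le, simp_all)
qed

text \<open>The analysis runs on real \<open>bounded_linear\<close> maps; this predicate carries the
  remaining half of complex linearity.\<close>

definition complex_homogeneous :: "('a::chilbert_space \<Rightarrow> 'a) \<Rightarrow> bool"
  where "complex_homogeneous T \<longleftrightarrow> (\<forall>a x. T (a *c x) = a *c T x)"

lemma bounded_operator_UNIV_D:
  assumes "bounded_operator UNIV T"
  shows "bounded_linear T" "complex_homogeneous T"
proof -
  obtain B where B: "\<And>x. norm (T x) \<le> B * norm x"
    using assms unfolding bounded_operator_def by auto
  show "bounded_linear T"
    using assms by (intro bounded_linear_intro[where K=B])
      (auto simp: bounded_operator_def scaleR_scaleC B mult.commute)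
  show "complex_homogeneous T"
    using assms by (auto simp: bounded_operator_def complex_homogeneous_def)
qed

lemma bounded_operatorI:
  assumes "bounded_linear T" "complex_homogeneous T" "T ` K \<subseteq> K"
  shows "bounded_operator K T"
proof -
  interpret bounded_linear T by (rule assms)
  show ?thesis
    using assms bounded unfolding bounded_operator_def complex_homogeneous_def
    by (auto simp: add mult.commute)
qed

text \<open>The real inner product controls only the real part of \<open>cinner (T x) x\<close>. The
  imaginary part is minus the real inner product of \<open>\<i> *c T x\<close> with
  \<open>x\<close>; moving \<open>T\<close> and then the scalar across shows that this product
  equals its own negative.\<close>

lemma positive_operatorI:
  assumes T: "bounded_linear T" "complex_homogeneous T" "T ` K \<subseteq> K"
    and sa: "\<And>x y. inner (T x) y = inner x (T y)" and pos: "\<And>x. 0 \<le> inner (T x) x"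
  shows "positive_operator K T"
proof -
  have "cinner (T x) x \<in> \<real>\<^sub>\<ge>\<^sub>0" for x
  proof -
    have "Im (cinner (T x) x) = - inner (\<i> *c T x) x"
      by (simp add: inner_eq_Re_cinner cinner_scaleC_left)
    moreover have "inner (\<i> *c T x) x = inner (\<i> *c x) (T x)"
      using T(2) sa by (metis complex_homogeneous_def)
    moreover have "inner (\<i> *c x) (T x) = - inner (\<i> *c T x) x"
    proof -
      have "- \<i> *c T x = - (\<i> *c T x)"
        by (rule complex_vector.scale_minus_left)
      then show ?thesis by (simp add: inner_scaleC_left[of _ x] inner_commute[of x])
    qed
    ultimately have "Im (cinner (T x) x) = 0" by linarith
    moreover have "0 \<le> Re (cinner (T x) x)" using pos[of x] by (simp add: inner_eq_Re_cinner)
    ultimately show ?thesis by (simp add: complex_nonneg_Reals_iff)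
  qed
  then show ?thesis
    unfolding positive_operator_def using bounded_operatorI[OF T] by blast
qed

lemma complex_homogeneous_adjoint:
  assumes T: "bounded_linear T" "complex_homogeneous T"
  shows "complex_homogeneous (adjoint T)"
proof -
  have "adjoint T (a *c x) = a *c adjoint T x" for a x
  proof (rule vector_eq_ldot[THEN iffD1], rule allI)
    fix y
    have "inner y (adjoint T (a *c x)) = inner (T (cnj a *c y)) x"
      using T(2) by (simp add: complex_homogeneous_def inner_scaleC_left flip: hilbert_adjoint_works[OF T(1)])
    then show "inner y (adjoint T (a *c x)) = inner y (a *c adjoint T x)"
      by (simp add: hilbert_adjoint_works[OF T(1)] inner_scaleC_left)
  qed
  then show ?thesis by (simp add: complex_homogeneous_def)
qed

text \<open>This is the row operator with entries \<open>A\<close> and \<open>B\<close>. Its range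
  is the sum of their ranges, so results about one operator apply to sums.\<close>

lemma adjoint_sum_map:
  fixes A B :: "'a::{real_inner,complete_space} \<Rightarrow> 'a"
  assumes A: "bounded_linear A" and B: "bounded_linear B"
  shows "bounded_linear (\<lambda>p. A (fst p) + B (snd p))"
    and "adjoint (\<lambda>p. A (fst p) + B (snd p)) x = (adjoint A x, adjoint B x)"
proof -
  show bl: "bounded_linear (\<lambda>p. A (fst p) + B (snd p))"
    by (intro bounded_linear_add bounded_linear_compose[OF A] bounded_linear_compose[OF B]
        bounded_linear_fst bounded_linear_snd)
  show "adjoint (\<lambda>p. A (fst p) + B (snd p)) x = (adjoint A x, adjoint B x)"
  proof (rule vector_eq_ldot[THEN iffD1], rule allI)
    fix p :: "'a \<times> 'a"
    show "inner p (adjoint (\<lambda>p. A (fst p) + B (snd p)) x) = inner p (adjoint A x, adjoint B x)"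
      unfolding hilbert_adjoint_works[OF bl, symmetric]
      by (simp add: inner_prod_def inner_add_left hilbert_adjoint_works[OF A] hilbert_adjoint_works[OF B])
  qed
qed

text \<open>Used twice: for \<open>A\<close> and \<open>B\<close> it yields \<open>X\<close>; later
  it turns a description of \<open>S\<close> by pairs of vectors into the range of a single
  operator. The last conclusion allows restricting to a closed subspace without losing
  range.\<close>

lemma sum_of_ranges_eq_range_positive:
  fixes A B :: "'a::chilbert_space \<Rightarrow> 'a"
  assumes A: "bounded_linear A" "complex_homogeneous A" and B: "bounded_linear B" "complex_homogeneous B"
  obtains X where "bounded_linear X" "complex_homogeneous X"
    "\<And>x y. inner (X x) y = inner x (X y)" "\<And>x. 0 \<le> inner (X x) x"
    "\<And>x. X (X x) = A (adjoint A x) + B (adjoint B x)"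
    "range X = range A + range B" "X ` closure (range X) = range X"
proof -
  let ?R = "\<lambda>p. A (fst p) + B (snd p)"
  obtain X where X: "bounded_linear X" "\<And>x y. inner (X x) y = inner x (X y)" "\<And>x. 0 \<le> inner (X x) x"
    "\<And>x. X (X x) = A (adjoint A x) + B (adjoint B x)" "range X = range ?R" "X ` closure (range X) = range X"
    "\<And>W x. bounded_linear W \<Longrightarrow>
      (\<And>x. W (A (adjoint A x) + B (adjoint B x)) = A (adjoint A (W x)) + B (adjoint B (W x))) \<Longrightarrow>
      W (X x) = X (W x)"
    by (rule range_eq_range_positive[OF adjoint_sum_map(1)[OF A(1) B(1)],
          unfolded adjoint_sum_map(2)[OF A(1) B(1)] fst_conv snd_conv]) blast
  have "A u + B v \<in> range ?R" for u v
    by (rule range_eqI[of _ _ "(u, v)"]) simp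
  then have "range ?R = range A + range B"
    by (auto simp: set_plus_def)
  \<comment> \<open>Multiplication by a complex scalar is a bounded real-linear map, so the
    commutation clause of the square root applies to it.\<close>
  moreover have "complex_homogeneous X"
    unfolding complex_homogeneous_def
  proof clarify
    fix a x
    show "X (a *c x) = a *c X x"
      using X(7)[OF bounded_linear_scaleC] A(2) B(2)
        complex_homogeneous_adjoint[OF A] complex_homogeneous_adjoint[OF B]
      by (simp add: complex_homogeneous_def scaleC_add_right)
  qed
  ultimately show ?thesis using that[of X] X by simp
qed

text \<open>Both \<open>V (a *c u)\<close> and \<open>a *c V u\<close> lie in the closure of the
  range, which is stable under complex scalars, and \<open>X\<close> is injective there.\<close>

lemma complex_homogeneous_factor:
  assumes X: "bounded_linear X" "complex_homogeneous X" and sa: "\<And>x y. inner (X x) y = inner x (X y)"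
    and A: "complex_homogeneous A"
    and V: "range V \<subseteq> closure (range X)" "\<And>u. X (V u) = A u"
  shows "complex_homogeneous V"
  unfolding complex_homogeneous_def
proof (intro allI)
  fix a u
  have "(*c) a ` closure (range X) \<subseteq> closure ((*c) a ` range X)"
    by (rule closure_bounded_linear_image_subset[OF bounded_linear_scaleC])
  also have "\<dots> \<subseteq> closure (range X)"
    by (intro closure_mono) (auto simp flip: X(2)[unfolded complex_homogeneous_def, rule_format])
  finally have "a *c V u \<in> closure (range X)" using V(1) by blast
  moreover have "X (V (a *c u)) = X (a *c V u)"
    using X(2) A by (simp add: complex_homogeneous_def V(2))
  ultimately show "V (a *c u) = a *c V u"
    using inj_onD[OF inj_on_closure_range_selfadjoint[OF X(1) sa]] V(1) by blast
qed

lemma complex_subspace_range: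
  assumes "bounded_linear T" "complex_homogeneous T"
  shows "complex_vector.subspace (range T)"
proof -
  interpret bounded_linear T by (rule assms)
  show ?thesis
  proof (rule complex_vector.subspaceI)
    show "0 \<in> range T" using zero by (metis rangeI)
    show "x + y \<in> range T" if "x \<in> range T" "y \<in> range T" for x y
      using that by (auto simp flip: add)
    show "c *c x \<in> range T" if "x \<in> range T" for c x
      using that by (auto simp flip: assms(2)[unfolded complex_homogeneous_def, rule_format])
  qed
qed

section \<open>The projection relation after cancelling the quasi-affinity\<close>

theorem corollary5p6:
  fixes M N :: "'a::chilbert_space set"
  defines "K \<equiv> closure (M + N)"
  assumes "separable_space (euclidean :: 'a topology)"
    and "operator_range UNIV M" and "operator_range UNIV N"
  shows "\<exists>X C S.
    positive_operator K X \<and> quasi_affinity K X \<and>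
    positive_operator K C \<and> contraction K C \<and>
    S \<subseteq> K \<and> operator_range K S \<and>
    graph_on K C \<inter> ({0} \<times> S) = {0} \<and>
    proj_rel M N \<odot> graph_on K X = graph_on K X \<odot> (graph_on K C + {0} \<times> S)"
proof -
  obtain A where "bounded_operator UNIV A" and M: "M = range A"
    using assms unfolding operator_range_def by blast
  then have A: "bounded_linear A" "complex_homogeneous A" by (auto dest: bounded_operator_UNIV_D)
  obtain B where "bounded_operator UNIV B" and N: "N = range B"
    using assms unfolding operator_range_def by blast
  then have B: "bounded_linear B" "complex_homogeneous B" by (auto dest: bounded_operator_UNIV_D)
  obtain X where X: "bounded_linear X" "complex_homogeneous X"
    and Xsa: "\<And>x y. inner (X x) y = inner x (X y)" and Xpos: "\<And>x. 0 \<le> inner (X x) x"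
    and XX: "\<And>x. X (X x) = A (adjoint A x) + B (adjoint B x)"
    and ranX: "range X = range A + range B" and XK: "X ` closure (range X) = range X"
    by (rule sum_of_ranges_eq_range_positive[OF A B]) blast
  have K: "K = closure (range X)" by (simp add: K_def M N ranX)
  have normX: "(norm (X x))\<^sup>2 = (norm (adjoint A x))\<^sup>2 + (norm (adjoint B x))\<^sup>2" for x
    unfolding power2_norm_eq_inner Xsa XX
    by (simp add: inner_add_right hilbert_adjoint_works2[OF A(1)] hilbert_adjoint_works2[OF B(1)])
  have le: "norm (adjoint A x) \<le> norm (X x)" "norm (adjoint B x) \<le> norm (X x)" for x
    by (rule power2_le_imp_le, simp add: normX, simp)+
  obtain A1 where A1: "bounded_linear A1" "\<And>u. norm (A1 u) \<le> norm u"
    "range A1 \<subseteq> closure (range X)" "\<And>u. X (A1 u) = A u"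
    by (rule douglas_factorization[OF X(1) Xsa A(1) le(1)]) blast
  obtain B1 where B1: "bounded_linear B1" "\<And>u. norm (B1 u) \<le> norm u"
    "range B1 \<subseteq> closure (range X)" "\<And>u. X (B1 u) = B u"
    by (rule douglas_factorization[OF X(1) Xsa B(1) le(2)]) blast
  have hA1: "complex_homogeneous A1" and hB1: "complex_homogeneous B1"
    using complex_homogeneous_factor[OF X Xsa A(2) A1(3,4)]
      complex_homogeneous_factor[OF X Xsa B(2) B1(3,4)] by auto
  define C where "C = (\<lambda>x. A1 (adjoint A1 x))"
  \<comment> \<open>On \<open>K\<close> this will be the identity minus \<open>C\<close>; the form
    through \<open>B1\<close> makes its membership in \<open>range B1\<close> visible.\<close>
  define D where "D = (\<lambda>x. B1 (adjoint B1 x))"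
  define S where "S = range A1 \<inter> range B1"
  note A1' = bounded_linear_hilbert_adjoint[OF A1(1)]
  note B1' = bounded_linear_hilbert_adjoint[OF B1(1)]
  interpret X: bounded_linear X by (rule X)
  interpret A1: bounded_linear A1 by (rule A1)
  interpret B1: bounded_linear B1 by (rule B1)
  interpret A1': bounded_linear "adjoint A1" by (rule A1')
  interpret B1': bounded_linear "adjoint B1" by (rule B1')
  have C: "bounded_linear C" "complex_homogeneous C"
    and D: "bounded_linear D" "complex_homogeneous D"
    unfolding C_def D_def
    using bounded_linear_compose[OF A1(1) A1'] bounded_linear_compose[OF B1(1) B1'] hA1 hB1
      complex_homogeneous_adjoint[OF A1(1) hA1] complex_homogeneous_adjoint[OF B1(1) hB1]
    by (simp_all add: complex_homogeneous_def)
  have A1K: "A1 u \<in> K" and B1K: "B1 u \<in> K" and XinK: "X u \<in> K" for u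
    using A1(3) B1(3) closure_subset[of "range X"] by (auto simp: K)
  have subK: "subspace K"
    unfolding K by (intro subspace_closure linear_subspace_image X.linear_axioms subspace_UNIV)
  note inj = inj_onD[OF inj_on_closure_range_selfadjoint[OF X(1) Xsa], folded K]

  \<comment> \<open>The equation is first obtained on \<open>range X\<close> by cancelling
    \<open>X\<close> on the left, then extended to its closure because the solution set is
    closed.\<close>
  have CD: "C x + D x = x" if "x \<in> K" for x
  proof -
    have "adjoint A x = adjoint A1 (X x)" "adjoint B x = adjoint B1 (X x)" for x
      by (rule vector_eq_ldot[THEN iffD1],
          simp add: A1(4) B1(4) flip: hilbert_adjoint_works[OF A(1)] hilbert_adjoint_works[OF B(1)]
            hilbert_adjoint_works[OF A1(1)] hilbert_adjoint_works[OF B1(1)] Xsa)+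
    then have "X (C (X x) + D (X x)) = X (X x)" for x
      by (simp add: X.add C_def D_def A1(4) B1(4) XX)
    then have "C (X x) + D (X x) = X x" for x
      by (rule inj) (auto intro: subspace_add[OF subK] simp: C_def D_def A1K B1K XinK)
    then have "range X \<subseteq> {x. C x + D x = x}" by blast
    moreover have "closed {x. C x + D x = x}"
      by (intro closed_Collect_eq continuous_on_add linear_continuous_on C D continuous_on_id)
    ultimately show ?thesis using that closure_minimal unfolding K by blast
  qed

  have hCB: "complex_homogeneous (\<lambda>v. C (B1 v))" and hDA: "complex_homogeneous (\<lambda>u. D (A1 u))"
    using C(2) D(2) hA1 hB1 by (simp_all add: complex_homogeneous_def)
  \<comment> \<open>\<open>operator_range K S\<close> asks for an operator from \<open>K\<close> to
    \<open>K\<close>, while \<open>S\<close> arises from pairs of ambient vectors; \<open>T\<close>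
    replaces the pairs by one vector.\<close>
  obtain T where T: "bounded_linear T" "complex_homogeneous T"
    and ranT: "range T = range (\<lambda>v. C (B1 v)) + range (\<lambda>u. D (A1 u))"
    and TT: "T ` closure (range T) = range T"
    by (rule sum_of_ranges_eq_range_positive[OF bounded_linear_compose[OF C(1) B1(1)] hCB
          bounded_linear_compose[OF D(1) A1(1)] hDA]) blast
  have ST: "S = range T"
  proof
    show "S \<subseteq> range T"
    proof
      fix a assume "a \<in> S"
      then obtain u v where "a = A1 u" "a = B1 v" unfolding S_def by blast
      \<comment> \<open>Split \<open>a\<close> as \<open>C a + D a\<close> and insert the two
        representations crosswise: \<open>B1 v\<close> under \<open>C\<close>, \<open>A1 u\<close>
        under \<open>D\<close>.\<close>
      then have "a = C (B1 v) + D (A1 u)" using CD[OF A1K[of u]] by simp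
      then show "a \<in> range T" unfolding ranT by (auto simp: set_plus_def)
    qed
    show "range T \<subseteq> S"
    proof
      fix a assume "a \<in> range T"
      then obtain u v where a: "a = C (B1 v) + D (A1 u)" unfolding ranT by (auto simp: set_plus_def)
      \<comment> \<open>Trading \<open>D (A1 u)\<close> for \<open>A1 u - C (A1 u)\<close> puts
        \<open>a\<close> in \<open>range A1\<close>; trading \<open>C (B1 v)\<close> for
        \<open>B1 v - D (B1 v)\<close> puts it in \<open>range B1\<close>.\<close>
      have "C (A1 u) + D (A1 u) = A1 u" "C (B1 v) + D (B1 v) = B1 v" by (rule CD A1K B1K)+
      then have "a = A1 (adjoint A1 (B1 v)) + (A1 u - A1 (adjoint A1 (A1 u)))"
        "a = (B1 v - B1 (adjoint B1 (B1 v))) + B1 (adjoint B1 (A1 u))"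
        unfolding a C_def D_def by (simp_all add: algebra_simps)
      then have "a = A1 (adjoint A1 (B1 v) + (u - adjoint A1 (A1 u)))"
        "a = B1 ((v - adjoint B1 (B1 v)) + adjoint B1 (A1 u))"
        unfolding A1.add A1.diff B1.add B1.diff .
      then show "a \<in> S" unfolding S_def by blast
    qed
  qed
  have SK: "S \<subseteq> K" unfolding S_def using A1K by blast
  have "closure (range T) \<subseteq> K"
    using SK by (intro closure_minimal) (simp_all add: ST K)
  then have TK: "T ` K = S" using TT ST by blast

  have Ssub: "complex_vector.subspace S"
    unfolding S_def by (intro complex_vector.subspace_inter complex_subspace_range A1(1) B1(1) hA1 hB1)

  have eq: "proj_rel M N \<odot> graph_on K X = graph_on K X \<odot> (graph_on K C + {0} \<times> S)"
  proof (intro set_eqI iffI; clarify)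
    fix x y
    assume "(x, y) \<in> proj_rel M N \<odot> graph_on K X"
    then obtain u v where x: "x \<in> K" and uv: "X x = A u + B v" and y: "y = A u"
      unfolding rel_mult_def proj_rel_def graph_on_def M N by auto
    have "X x = X (A1 u + B1 v)" by (simp add: uv X.add A1(4) B1(4))
    then have xuv: "x = A1 u + B1 v"
      by (rule inj) (auto intro: x subspace_add[OF subK] A1K B1K)
    \<comment> \<open>The vector \<open>A1 u\<close> may differ from \<open>C x\<close>, but the
      difference belongs to both ranges: directly to that of \<open>A1\<close>, and through
      \<open>C x + D x = x\<close> to that of \<open>B1\<close>.\<close>
    have "A1 u - C x = A1 (u - adjoint A1 x)" by (simp add: C_def A1.diff)
    moreover have "A1 u - C x = D x - B1 v"
      using CD[OF x] xuv by (simp add: algebra_simps)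
    then have "A1 u - C x = B1 (adjoint B1 x - v)" by (simp add: D_def B1.diff)
    ultimately have "A1 u - C x \<in> S" unfolding S_def by blast
    then have "(0, A1 u - C x) \<in> {0} \<times> S" by simp
    moreover have "(x, C x) \<in> graph_on K C" using x unfolding graph_on_def by blast
    ultimately have "(x, C x) + (0, A1 u - C x) \<in> graph_on K C + {0} \<times> S" by (rule set_plus_intro[rotated])
    then have "(x, A1 u) \<in> graph_on K C + {0} \<times> S" by simp
    moreover have "(A1 u, y) \<in> graph_on K X" using A1K y unfolding graph_on_def by (auto simp: A1(4))
    ultimately show "(x, y) \<in> graph_on K X \<odot> (graph_on K C + {0} \<times> S)"
      unfolding rel_mult_def by blast
  next
    fix x y
    assume "(x, y) \<in> graph_on K X \<odot> (graph_on K C + {0} \<times> S)"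
    then obtain s where x: "x \<in> K" and s: "s \<in> S" and y: "y = X (C x + s)"
      unfolding rel_mult_def graph_on_def by (auto simp: set_plus_def)
    obtain u v where u: "s = A1 u" and v: "s = B1 v" using s unfolding S_def by blast
    have "y = A (adjoint A1 x + u)"
      unfolding y u C_def by (simp flip: A1.add A1(4))
    moreover have "X x = y + B (adjoint B1 x - v)"
    proof -
      have "x = (C x + s) + (D x - s)" using CD[OF x] by (simp add: algebra_simps)
      then have "X x = X (C x + s) + X (D x - s)" by (metis X.add)
      moreover have "D x - s = B1 (adjoint B1 x - v)" by (simp add: D_def v B1.diff)
      ultimately show ?thesis by (simp add: y B1(4))
    qed
    ultimately have "(X x, y) \<in> proj_rel M N"
      unfolding proj_rel_def M N by blast
    then show "(x, y) \<in> proj_rel M N \<odot> graph_on K X"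
      using x unfolding rel_mult_def graph_on_def by blast
  qed

  have Cimg: "C ` K \<subseteq> K" unfolding C_def using A1K by blast
  have "inner (C x) y = inner (adjoint A1 x) (adjoint A1 y)" for x y
    unfolding C_def by (rule hilbert_adjoint_works[OF A1(1)])
  then have "positive_operator K C"
    by (intro positive_operatorI C Cimg) (metis inner_commute, simp)
  moreover have "contraction K C"
  proof -
    have "norm (C x) \<le> norm x" for x
      unfolding C_def
      using order_trans[OF A1(2)[of "adjoint A1 x"], of "norm x"]
        hilbert_adjoint_norm_le[OF A1(1), of 1 x] A1(2) by simp
    then show ?thesis unfolding contraction_def using bounded_operatorI[OF C Cimg] by blast
  qed
  moreover have Ximg: "X ` K \<subseteq> K" using XinK by blast
  then have "positive_operator K X"
    by (intro positive_operatorI X Xsa Xpos)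
  \<comment> \<open>By \<open>XK\<close> the restriction of \<open>X\<close> to \<open>K\<close>
    keeps the full range, whose closure is \<open>K\<close>; this gives density.\<close>
  moreover have "quasi_affinity K X"
    unfolding quasi_affinity_def
    using bounded_operatorI[OF X Ximg] inj_on_closure_range_selfadjoint[OF X(1) Xsa] XK
    by (simp add: K)
  moreover have "operator_range K S"
    unfolding operator_range_def using Ssub TK SK bounded_operatorI[OF T, of K] by metis
  moreover have "graph_on K C \<inter> ({0} \<times> S) = {0}"
    using subspace_0[OF subK] complex_vector.subspace_0[OF Ssub]
    by (auto simp: graph_on_def C_def A1.zero A1'.zero zero_prod_def)
  ultimately show ?thesis using SK eq by blast
qed

end
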